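(* Let $q\in[1,\infty]$, $\beta\in\mathbb{R}$, and let $p$ be the conjugate exponent, $\frac1p+\frac1q=1$. Let $\lambda_1,\dots,\lambda_n$ be distinct points of $\mathbb{D}$, let $w_1,\dots,w_n\in\mathbb{C}$ and let $C>0$. There exists $f\in l_A^q(-\beta)$ such that $f(\lambda_i)=w_i$ for $1\le i\le n$ and $\|f\|_{l_A^q(-\beta)}\le C$ if and only if $$\Big|\sum_{i=1}^n\alpha_iw_i\Big|\le C\left(\Big|\sum_{i=1}^n\alpha_i\Big|^p+\sum_{j\ge1}j^{\beta p}\Big|\sum_{i=1}^n\alpha_i\lambda_i^j\Big|^p\right)^{1/p}$$ holds for every sequence of complex numbers $(\alpha_i)_{i=1}^n$. (When $p=\infty$ the right-hand side is read as $C\sup\{|\sum_i\alpha_i|,\ \sup_{j\ge1}j^\beta|\sum_i\alpha_i\lambda_i^j|\}$.)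
   Context: For $\gamma\in\mathbb{R}$ and $q\in[1,\infty]$, the Beurling–Sobolev space $l_A^q(\gamma)$ consists of all $f=\sum_{j\ge0}\hat f(j)z^j$ holomorphic on the open unit disk $\mathbb{D}$ with $$\|f\|_{l_A^q(\gamma)}=\Big(\sum_{j\ge0}|\hat f(j)|^q\omega_j^q\Big)^{1/q}<\infty,\qquad \omega_0=1,\ \omega_j=j^\gamma\ (j\ge1),$$ with the norm $\sup_{j\ge0}|\hat f(j)|\omega_j$ when $q=\infty$. *)

theory Defs
  imports "HOL-Complex_Analysis.Complex_Analysis"
begin

definition taylor_coeff :: "(complex \<Rightarrow> complex) \<Rightarrow> nat \<Rightarrow> complex" where
  "taylor_coeff f j = fps_nth (fps_expansion f 0) j"

definition bs_weight :: "real \<Rightarrow> nat \<Rightarrow> real" where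
  "bs_weight \<gamma> j = (if j = 0 then 1 else real j powr \<gamma>)"

text \<open>
  The exponent \<open>q\<close> ranges over extended nonnegative reals, with \<open>\<infinity>\<close> the supremum case. Elements
  of the space are total functions; their values off the open unit disk are irrelevant. The norm
  is real-valued and meaningful only on members of the space, where the series converges
  (resp. the supremum is over a bounded set).
\<close>

definition beurling_sobolev :: "ennreal \<Rightarrow> real \<Rightarrow> (complex \<Rightarrow> complex) set" where
  "beurling_sobolev q \<gamma> = {f. f holomorphic_on ball 0 1 \<and>
     (if q = \<infinity> then bdd_above (range (\<lambda>j. norm (taylor_coeff f j) * bs_weight \<gamma> j))
      else summable (\<lambda>j. norm (taylor_coeff f j) powr enn2real q * bs_weight \<gamma> j powr enn2real q))}"

definition bs_norm :: "ennreal \<Rightarrow> real \<Rightarrow> (complex \<Rightarrow> complex) \<Rightarrow> real" where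
  "bs_norm q \<gamma> f =
     (if q = \<infinity> then (SUP j. norm (taylor_coeff f j) * bs_weight \<gamma> j)
      else (\<Sum>j. norm (taylor_coeff f j) powr enn2real q * bs_weight \<gamma> j powr enn2real q)
             powr (1 / enn2real q))"

end

theory Submission
  imports Defs "HOL-Real_Asymp.Real_Asymp"
begin

text \<open>
  Put \<open>x j = taylor_coeff f j * bs_weight (- \<beta>) j\<close>. Members of the ball of radius \<open>C\<close> correspond to
  points \<open>x\<close> of the \<open>C\<close>-ball of \<open>l^q\<close>, and the values \<open>f (lam i)\<close> to pairings of \<open>x\<close> with the
  summable sequences \<open>u i j = bs_weight \<beta> j * lam i ^ j\<close>. Necessity of the condition is Hoelder's
  inequality. For sufficiency, the ball is convex and compact in the product topology, on which
  \<open>x \<mapsto> (\<Sum>j. x j * u i j)\<close> is continuous because \<open>u i\<close> is summable and the ball is uniformly bounded;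
  this holds for all \<open>q\<close>, including \<open>1\<close> and \<open>\<infinity>\<close>. So there is an \<open>x\<close> whose values are closest to \<open>w\<close>
  in the Euclidean norm; the variational inequality at \<open>x\<close> together with the condition for
  \<open>\<alpha> =\<close> conjugated residual forces the residual to vanish.
\<close>

section \<open>Conjugate exponents and convexity of powers\<close>

text \<open>Reduces extended exponents to real arithmetic: away from the two endpoint pairs both
  exponents are finite and greater than 1, as Young's inequality requires.\<close>

lemma conjugate_exponent_cases:
  fixes p q :: ennreal
  assumes "1 \<le> q" "1 / p + 1 / q = 1"
  obtains "q = 1" "p = \<infinity>" | "q = \<infinity>" "p = 1"
    | P Q :: real where "P > 1" "Q > 1" "1 / P + 1 / Q = 1" "p = ennreal P" "q = ennreal Q"
proof -
  \<comment> \<open>In \<open>ennreal\<close>, \<open>1 / 0 = \<infinity>\<close>, so a zero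
    exponent would make the sum of the reciprocals infinite.\<close>
  have pos: "r > 0" if "p = ennreal r" "r \<ge> 0" for r
    using that assms(2) by (cases "r = 0") (auto simp: ennreal_divide_zero)
  have inv: "1 / ennreal r = ennreal (1 / r)" if "r > 0" for r
    using that by (simp add: divide_ennreal ennreal_1[symmetric] del: ennreal_1)
  show ?thesis
  proof (cases "q = \<infinity>")
    case True
    show ?thesis
    proof (cases p)
      case (real r)
      then have "ennreal (1 / r) = ennreal 1"
        using assms(2) True pos inv by simp
      then have "r = 1" using pos real by (subst (asm) ennreal_inj) auto
      then show ?thesis using True real that(2) by simp
    next
      case top
      then show ?thesis using assms(2) True by simp
    qed
  next
    case False
    then obtain Q where Q: "q = ennreal Q" "Q \<ge> 0" by (cases q) auto
    with assms(1) have Q1: "Q \<ge> 1" by (simp add: ennreal_1[symmetric] del: ennreal_1)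
    then have iq: "1 / q = ennreal (1 / Q)" using Q inv by simp
    show ?thesis
    proof (cases p)
      case (real P)
      then have "P > 0" using pos by blast
      then have "1 / p = ennreal (1 / P)" using real inv by simp
      with iq assms(2) have "ennreal (1 / P + 1 / Q) = ennreal 1"
        using \<open>P > 0\<close> Q1 by (simp add: ennreal_plus[symmetric] del: ennreal_plus)
      then have PQ: "1 / P + 1 / Q = 1"
        using \<open>P > 0\<close> Q1 by (subst (asm) ennreal_inj) auto
      moreover have "1 / P > 0" "1 / Q > 0" using \<open>P > 0\<close> Q1 by auto
      ultimately have "1 / P < 1" "1 / Q < 1" by linarith+
      then have "P > 1" "Q > 1" using \<open>P > 0\<close> Q1 by (auto simp: field_simps)
      then show ?thesis using PQ real Q that(3) by blast
    next
      case top
      then have "ennreal (1 / Q) = ennreal 1" using assms(2) iq by simp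
      then have "Q = 1" using Q1 by (subst (asm) ennreal_inj) auto
      then show ?thesis using top Q that(1) by simp
    qed
  qed
qed

text \<open>Convexity of the power function settles positive \<open>a\<close> and \<open>b\<close>.
  If one of them vanishes, \<open>0 powr r = 0\<close> reduces the claim to
  \<open>s powr r \<le> s\<close> on the unit interval.\<close>

lemma powr_convex_combination:
  fixes a b t r :: real
  assumes "r \<ge> 1" "a \<ge> 0" "b \<ge> 0" "0 \<le> t" "t \<le> 1"
  shows "((1 - t) * a + t * b) powr r \<le> (1 - t) * a powr r + t * b powr r"
proof -
  have le: "s powr r \<le> s" if "0 \<le> s" "s \<le> 1" for s :: real
    using powr_mono'[of 1 r s] assms that by simp
  consider "a = 0" | "b = 0" | "a > 0" "b > 0" using assms by linarith
  then show ?thesis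
  proof cases
    case 1
    then show ?thesis using assms le[of t] by (simp add: powr_mult mult_right_mono)
  next
    case 2
    then show ?thesis using assms le[of "1 - t"] by (simp add: powr_mult mult_right_mono)
  next
    case 3
    then show ?thesis
      using convex_onD[OF powr_convex[OF assms(1)] assms(4,5), of a b] by simp
  qed
qed

section \<open>The ball of \<open>l^q\<close>: convexity and compactness\<close>

definition lq_norm :: "ennreal \<Rightarrow> (nat \<Rightarrow> complex) \<Rightarrow> real" where
  "lq_norm r x = (if r = \<infinity> then SUP j. norm (x j)
     else (\<Sum>j. norm (x j) powr enn2real r) powr (1 / enn2real r))"

text \<open>Bounding partial sums instead of \<open>lq_norm\<close> builds summability into
  membership and makes the ball an intersection of conditions on finitely many coordinates, which
  are closed in the product topology.\<close>

definition lq_ball :: "ennreal \<Rightarrow> real \<Rightarrow> (nat \<Rightarrow> complex) set" where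
  "lq_ball q C = {x. if q = \<infinity> then \<forall>j. norm (x j) \<le> C
     else \<forall>N. (\<Sum>j<N. norm (x j) powr enn2real q) \<le> C powr enn2real q}"

lemma enn2real_ge_1:
  assumes "1 \<le> q" "q \<noteq> (\<infinity> :: ennreal)"
  shows "1 \<le> enn2real q"
  using assms by (cases q) (auto simp: ennreal_1[symmetric] simp del: ennreal_1)

lemma powr_le_powr_iff:
  fixes a b r :: real
  assumes "a \<ge> 0" "b \<ge> 0" "r > 0"
  shows "a powr r \<le> b powr r \<longleftrightarrow> a \<le> b"
  using assms powr_mono2[of r a b] powr_less_mono2[of r b a] by force

text \<open>Nonnegative terms with bounded partial sums are summable, with the same bound for the
  total; taking \<open>r\<close>-th roots then gives the norm. Summability has to be stated beside
  the bound because \<open>suminf\<close> says nothing about a divergent series.\<close>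

lemma lq_ball_iff:
  assumes "1 \<le> q" "C \<ge> 0"
  shows "x \<in> lq_ball q C \<longleftrightarrow>
    (if q = \<infinity> then bdd_above (range (\<lambda>j. norm (x j)))
     else summable (\<lambda>j. norm (x j) powr enn2real q)) \<and> lq_norm q x \<le> C"
proof (cases "q = \<infinity>")
  case True
  have "(\<forall>j. norm (x j) \<le> C) \<longleftrightarrow> bdd_above (range (\<lambda>j. norm (x j))) \<and> (SUP j. norm (x j)) \<le> C"
    by (metis UNIV_I UNIV_not_empty bdd_aboveI2 cSUP_le_iff)
  then show ?thesis using True by (simp add: lq_ball_def lq_norm_def)
next
  case False
  define r where "r = enn2real q"
  have r: "r \<ge> 1" using enn2real_ge_1[OF assms(1) False] by (simp add: r_def)
  let ?f = "\<lambda>j. norm (x j) powr r"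
  have "(\<forall>N. sum ?f {..<N} \<le> C powr r) \<longleftrightarrow> summable ?f \<and> suminf ?f \<le> C powr r"
  proof safe
    assume le: "\<forall>N. sum ?f {..<N} \<le> C powr r"
    then show "summable ?f" by (intro summableI_nonneg_bounded[of _ "C powr r"]) auto
    then show "suminf ?f \<le> C powr r" using le by (intro suminf_le_const) auto
  next
    fix N
    assume "summable ?f" "suminf ?f \<le> C powr r"
    moreover from this have "sum ?f {..<N} \<le> suminf ?f" by (intro sum_le_suminf) auto
    ultimately show "sum ?f {..<N} \<le> C powr r" by linarith
  qed
  also have "\<dots> \<longleftrightarrow> summable ?f \<and> suminf ?f powr (1 / r) \<le> C"
  proof (intro conj_cong refl)
    assume "summable ?f"
    then have "0 \<le> suminf ?f" by (simp add: suminf_nonneg)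
    then have "suminf ?f = (suminf ?f powr (1 / r)) powr r" using r by (simp add: powr_powr)
    then show "suminf ?f \<le> C powr r \<longleftrightarrow> suminf ?f powr (1 / r) \<le> C"
      using powr_le_powr_iff[of "suminf ?f powr (1 / r)" C r] r assms(2) by simp
  qed
  finally show ?thesis using False by (simp add: lq_ball_def lq_norm_def r_def)
qed

text \<open>A single term is at most a partial sum. This coordinate bound places the ball in a
  product of discs and dominates the pairings with summable sequences.\<close>

lemma norm_le_of_lq_ball:
  assumes "1 \<le> q" "C \<ge> 0" "x \<in> lq_ball q C"
  shows "norm (x j) \<le> C"
proof (cases "q = \<infinity>")
  case True
  then show ?thesis using assms by (simp add: lq_ball_def)
next
  case False
  define r where "r = enn2real q"
  have r: "r \<ge> 1" using enn2real_ge_1[OF assms(1) False] by (simp add: r_def)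
  have "norm (x j) powr r \<le> (\<Sum>i<Suc j. norm (x i) powr r)"
    by (intro member_le_sum) auto
  also have "\<dots> \<le> C powr r" using assms(3) False unfolding lq_ball_def r_def by (simp del: sum.lessThan_Suc)
  finally show ?thesis using r assms(2) by (subst (asm) powr_le_powr_iff) auto
qed

text \<open>Minkowski's inequality is avoided: the triangle inequality in each coordinate and
  convexity of the power, summed up to \<open>N\<close>, already preserve the bound.\<close>

lemma lq_ball_convex:
  assumes "1 \<le> q" "x \<in> lq_ball q C" "y \<in> lq_ball q C" "0 \<le> t" "t \<le> 1"
  shows "(\<lambda>j. (1 - of_real t) * x j + of_real t * y j) \<in> lq_ball q C"
proof -
  have n: "norm ((1 - of_real t) * x j + of_real t * y j) \<le> (1 - t) * norm (x j) + t * norm (y j)" for j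
  proof -
    have "norm (1 - complex_of_real t) = 1 - t"
      using assms norm_of_real[of "1 - t", where 'a = complex] by simp
    then have "norm ((1 - of_real t) * x j) = (1 - t) * norm (x j)"
      by (simp add: norm_mult)
    moreover have "norm (of_real t * y j) = t * norm (y j)"
      using assms by (simp add: norm_mult)
    ultimately show ?thesis by (metis norm_triangle_ineq)
  qed
  show ?thesis
  proof (cases "q = \<infinity>")
    case True
    have "(1 - t) * norm (x j) + t * norm (y j) \<le> C" for j
      using assms True by (intro convex_bound_le) (auto simp: lq_ball_def)
    then have "norm ((1 - of_real t) * x j + of_real t * y j) \<le> C" for j
      using order_trans[OF n] by blast
    then show ?thesis using True by (simp add: lq_ball_def)
  next
    case False
    define r where "r = enn2real q"
    have r: "r \<ge> 1" using enn2real_ge_1[OF assms(1) False] by (simp add: r_def)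
    have "(\<Sum>j<N. norm ((1 - of_real t) * x j + of_real t * y j) powr r) \<le> C powr r" for N
    proof -
      have "(\<Sum>j<N. norm ((1 - of_real t) * x j + of_real t * y j) powr r)
          \<le> (\<Sum>j<N. ((1 - t) * norm (x j) + t * norm (y j)) powr r)"
        using r n by (intro sum_mono powr_mono2) auto
      also have "\<dots> \<le> (\<Sum>j<N. (1 - t) * norm (x j) powr r + t * norm (y j) powr r)"
        using r assms by (intro sum_mono powr_convex_combination) auto
      also have "\<dots> = (1 - t) * (\<Sum>j<N. norm (x j) powr r) + t * (\<Sum>j<N. norm (y j) powr r)"
        by (simp add: sum.distrib sum_distrib_left)
      also have "\<dots> \<le> C powr r"
        using assms False by (intro convex_bound_le) (auto simp: lq_ball_def r_def)
      finally show ?thesis .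
    qed
    then show ?thesis using False by (simp add: lq_ball_def r_def)
  qed
qed

text \<open>By Tychonoff the product of the discs of radius \<open>C\<close> is compact, and the
  ball is a closed subset of it.\<close>

lemma lq_ball_compact:
  assumes "1 \<le> q" "C \<ge> 0"
  shows "compact (lq_ball q C)"
proof -
  have "compactin (product_topology (\<lambda>j::nat. euclidean) UNIV) (\<Pi>\<^sub>E j\<in>UNIV. cball (0::complex) C)"
    unfolding compactin_PiE by simp
  then have c: "compact (\<Pi>\<^sub>E j\<in>(UNIV::nat set). cball (0::complex) C)"
    by (simp add: euclidean_product_topology)
  have cl: "closed (lq_ball q C)"
  proof (cases "q = \<infinity>")
    case True
    have "lq_ball q C = (\<Inter>j. {x. norm (x j) \<le> C})" using True by (auto simp: lq_ball_def)
    also have "closed \<dots>"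
      by (intro closed_INT ballI closed_Collect_le continuous_intros continuous_on_product_coordinates)
    finally show ?thesis .
  next
    case False
    have r: "enn2real q \<ge> 1" using enn2real_ge_1[OF assms(1) False] .
    have "lq_ball q C = (\<Inter>N. {x. (\<Sum>j<N. norm (x j) powr enn2real q) \<le> C powr enn2real q})"
      using False by (auto simp: lq_ball_def)
    also have "closed \<dots>"
      using r by (intro closed_INT ballI closed_Collect_le continuous_on_sum continuous_on_powr'
          continuous_on_norm continuous_on_product_coordinates continuous_on_const) auto
    finally show ?thesis .
  qed
  have "lq_ball q C = (\<Pi>\<^sub>E j\<in>UNIV. cball 0 C) \<inter> lq_ball q C"
    using norm_le_of_lq_ball[OF assms] by auto
  then show ?thesis using compact_Int_closed[OF c cl] by simp
qed

lemma zero_in_lq_ball: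
  assumes "C \<ge> 0"
  shows "(\<lambda>j. 0) \<in> lq_ball q C"
  using assms by (simp add: lq_ball_def)

section \<open>Hoelder's inequality and its converse\<close>

lemma summable_mult_lq_ball:
  assumes "1 \<le> q" "C \<ge> 0" "x \<in> lq_ball q C" "summable (\<lambda>j. norm (g j))"
  shows "summable (\<lambda>j. norm (x j * g j))"
  by (rule summable_comparison_test'[of "\<lambda>j. C * norm (g j)" 0])
    (use norm_le_of_lq_ball[OF assms(1-3)] assms in
      \<open>auto simp: norm_mult intro!: summable_mult mult_right_mono\<close>)

text \<open>Summable terms are eventually below 1, where raising to a power \<open>r \<ge> 1\<close>
  does not increase them.\<close>

lemma summable_norm_powr:
  fixes g :: "nat \<Rightarrow> complex"
  assumes "summable (\<lambda>j. norm (g j))" "r \<ge> 1"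
  shows "summable (\<lambda>j. norm (g j) powr r)"
proof (rule summable_comparison_test_ev[OF _ assms(1)])
  have "eventually (\<lambda>j. norm (g j) < 1) sequentially"
    using summable_LIMSEQ_zero[OF assms(1)] by (rule order_tendstoD) simp
  then show "eventually (\<lambda>j. norm (norm (g j) powr r) \<le> norm (g j)) sequentially"
  proof eventually_elim
    case (elim j)
    then show ?case using powr_mono'[of 1 r "norm (g j)"] assms by simp
  qed
qed

lemma bdd_above_norm_of_summable:
  assumes "summable (\<lambda>j. norm (g j))"
  shows "bdd_above (range (\<lambda>j. norm (g j)))"
  using summable_imp_Bseq[OF assms] by (simp add: Bseq_eq_bounded bounded_imp_bdd_above)

lemma Hoelder_lq_ball:
  assumes "1 \<le> q" "1 / p + 1 / q = 1" "C > 0" "x \<in> lq_ball q C" "summable (\<lambda>j. norm (g j))"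
  shows "norm (\<Sum>j. x j * g j) \<le> C * lq_norm p g"
proof -
  have sx: "summable (\<lambda>j. norm (x j * g j))"
    by (rule summable_mult_lq_ball[OF assms(1) less_imp_le[OF assms(3)] assms(4,5)])
  have "(\<Sum>j. norm (x j * g j)) \<le> C * lq_norm p g"
    using assms(1,2)
  proof (cases rule: conjugate_exponent_cases)
    case 1
    let ?M = "SUP j. norm (g j)"
    have up: "norm (g j) \<le> ?M" for j
      using bdd_above_norm_of_summable[OF assms(5)] by (intro cSUP_upper) auto
    then have M0: "0 \<le> ?M" using norm_ge_zero order_trans by blast
    show ?thesis
    proof (rule suminf_le_const[OF sx])
      fix N
      have "(\<Sum>j<N. norm (x j * g j)) \<le> (\<Sum>j<N. norm (x j) * ?M)"
        by (auto intro!: sum_mono simp: norm_mult mult_left_mono up)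
      also have "\<dots> \<le> C * ?M"
        using assms(3,4) M0 1
        by (auto simp: sum_distrib_right[symmetric] lq_ball_def intro!: mult_right_mono)
      finally show "(\<Sum>j<N. norm (x j * g j)) \<le> C * lq_norm p g"
        using 1 by (simp add: lq_norm_def)
    qed
  next
    case 2
    have "(\<Sum>j. norm (x j * g j)) \<le> (\<Sum>j. C * norm (g j))"
      using 2 assms by (intro suminf_le sx summable_mult) (auto simp: lq_ball_def norm_mult mult_right_mono)
    also have "\<dots> = C * lq_norm p g"
      using 2 assms(5) by (simp add: lq_norm_def suminf_mult suminf_nonneg)
    finally show ?thesis .
  next
    case (3 P Q)
    let ?S = "\<Sum>j. norm (g j) powr P"
    define b where "b = ?S powr (1 / P)"
    have b: "lq_norm p g = b" using 3 by (simp add: lq_norm_def b_def)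
    have sg: "summable (\<lambda>j. norm (g j) powr P)" using assms(5) 3 by (intro summable_norm_powr) auto
    have S0: "?S \<ge> 0" using sg by (simp add: suminf_nonneg)
    show ?thesis
    \<comment> \<open>The argument below divides by \<open>b\<close>; if \<open>b = 0\<close>, then
      \<open>g\<close> vanishes identically.\<close>
    proof (cases "b = 0")
      case True
      then have "?S = 0" using S0 3 by (simp add: b_def)
      then have "g j = 0" for j using sg suminf_eq_zero_iff[OF sg] by simp
      then show ?thesis using b True by simp
    next
      case False
      then have b0: "b > 0" by (simp add: b_def order_less_le)
      have bP: "b powr P = ?S" using 3 S0 by (simp add: b_def powr_powr)
      have S: "?S > 0" using b0 bP by (metis powr_gt_zero order_less_irrefl)
      show ?thesis
      proof (rule suminf_le_const[OF sx])
        fix N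
        \<comment> \<open>Scaled by \<open>C\<close> and \<open>b\<close>, both sequences have norm
          at most 1, so Young's inequality sums to at most \<open>1 / Q + 1 / P = 1\<close>.\<close>
        have "(\<Sum>j<N. norm (x j) / C * (norm (g j) / b))
            \<le> (\<Sum>j<N. (norm (x j) / C) powr Q / Q + (norm (g j) / b) powr P / P)"
          using 3 b0 assms(3) by (intro sum_mono Youngs_inequality) auto
        also have "\<dots> = (\<Sum>j<N. norm (x j) powr Q) / (C powr Q) / Q + (\<Sum>j<N. norm (g j) powr P) / ?S / P"
          using b0 assms(3) by (simp add: sum.distrib sum_divide_distrib powr_divide bP)
        also have "\<dots> \<le> 1 / Q + 1 / P"
        proof (intro add_mono divide_right_mono)
          show "(\<Sum>j<N. norm (x j) powr Q) / (C powr Q) \<le> 1"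
            using assms(3,4) 3 by (simp add: lq_ball_def)
          show "(\<Sum>j<N. norm (g j) powr P) / ?S \<le> 1"
            using S sg by (simp add: sum_le_suminf)
        qed (use 3 in auto)
        also have "\<dots> = 1" using 3 by simp
        finally have "(\<Sum>j<N. norm (x j * g j)) / (C * b) \<le> 1"
          by (simp add: sum_divide_distrib norm_mult)
        then show "(\<Sum>j<N. norm (x j * g j)) \<le> C * lq_norm p g"
          using b b0 assms(3) by (simp add: divide_le_eq)
      qed
    qed
  qed
  then show ?thesis using summable_norm[OF sx] by linarith
qed

lemma cnj_sgn_mult: "cnj (sgn z) * z = of_real (norm z)"
  by (cases "z = 0") (simp_all add: sgn_eq complex_norm_square[symmetric] power2_eq_square field_simps)

text \<open>Converse of Hoelder's inequality, by testing \<open>B\<close> on extremal sequences. The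
  phase \<open>cnj (sgn (g j))\<close> makes each term of the pairing real and nonnegative, so
  bounds on real parts suffice.\<close>

lemma lq_norm_le_of_lq_ball:
  assumes "1 \<le> q" "1 / p + 1 / q = 1" "C > 0" "summable (\<lambda>j. norm (g j))"
    and B: "\<And>x. x \<in> lq_ball q C \<Longrightarrow> Re (\<Sum>j. x j * g j) \<le> B"
  shows "C * lq_norm p g \<le> B"
  using assms(1,2)
proof (cases rule: conjugate_exponent_cases)
  case 1
  have "norm (g k) \<le> B / C" for k
  proof -
    \<comment> \<open>For \<open>q = 1\<close> all the mass \<open>C\<close> sits on one coordinate,
      which recovers \<open>norm (g k)\<close>.\<close>
    let ?x = "\<lambda>j. if j = k then of_real C * cnj (sgn (g k)) else 0"
    have "(\<Sum>j<N. norm (?x j)) \<le> C" for N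
      using assms(3) by (auto simp: if_distrib[of norm] norm_mult norm_sgn cong: if_cong)
    then have "?x \<in> lq_ball q C" using 1 assms(3) by (simp add: lq_ball_def)
    moreover have "(\<Sum>j. ?x j * g j) = of_real (C * norm (g k))"
    proof -
      have "(\<Sum>j. ?x j * g j) = (\<Sum>j\<in>{k}. ?x j * g j)"
        by (rule suminf_finite) auto
      then show ?thesis by (simp add: mult.assoc cnj_sgn_mult)
    qed
    ultimately have "C * norm (g k) \<le> B" using B[of ?x] by simp
    then show ?thesis using assms(3) by (simp add: field_simps)
  qed
  then have "(SUP j. norm (g j)) \<le> B / C" by (intro cSUP_least) auto
  then show ?thesis using 1 assms(3) by (simp add: lq_norm_def field_simps)
next
  case 2
  let ?x = "\<lambda>j. of_real C * cnj (sgn (g j))"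
  have "?x \<in> lq_ball q C" using 2 assms(3) by (simp add: lq_ball_def norm_mult norm_sgn)
  moreover have "(\<Sum>j. ?x j * g j) = of_real (C * (\<Sum>j. norm (g j)))"
  proof -
    have "(\<Sum>j. ?x j * g j) = (\<Sum>j. complex_of_real (C * norm (g j)))"
      by (simp add: mult.assoc cnj_sgn_mult)
    also have "\<dots> = of_real (\<Sum>j. C * norm (g j))"
      by (intro suminf_of_real[symmetric] summable_mult assms(4))
    also have "(\<Sum>j. C * norm (g j)) = C * (\<Sum>j. norm (g j))"
      by (intro suminf_mult assms(4))
    finally show ?thesis .
  qed
  ultimately have "C * (\<Sum>j. norm (g j)) \<le> B" using B[of ?x] by simp
  then show ?thesis using 2 assms(4) by (simp add: lq_norm_def suminf_nonneg)
next
  case (3 P Q)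
  let ?S = "\<Sum>j. norm (g j) powr P"
  define b where "b = ?S powr (1 / P)"
  have b: "lq_norm p g = b" using 3 by (simp add: lq_norm_def b_def)
  have sg: "summable (\<lambda>j. norm (g j) powr P)" using assms(4) 3 by (intro summable_norm_powr) auto
  have S0: "?S \<ge> 0" using sg by (simp add: suminf_nonneg)
  show ?thesis
  proof (cases "b = 0")
    case True
    \<comment> \<open>The left-hand side is 0, and pairing with the zero sequence shows
      \<open>0 \<le> B\<close>.\<close>
    then show ?thesis using b B[OF zero_in_lq_ball] assms(3) by simp
  next
    case False
    then have b0: "b > 0" by (simp add: b_def order_less_le)
    have bP: "b powr P = ?S" using 3 S0 by (simp add: b_def powr_powr)
    have S: "?S > 0" using b0 bP by (metis powr_gt_zero order_less_irrefl)
    have PQ: "(P - 1) * Q = P" using 3 by (simp add: field_simps)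
    \<comment> \<open>The equality case of Hoelder: since \<open>(P - 1) * Q = P\<close>, the
      \<open>Q\<close>-th powers of the moduli are proportional to \<open>norm (g j) powr P\<close>.
      The factors \<open>C\<close> and \<open>b\<close> give \<open>?x\<close> norm \<open>C\<close>
      and pairing \<open>C * b\<close>.\<close>
    let ?x = "\<lambda>j. of_real (C * (norm (g j) / b) powr (P - 1)) * cnj (sgn (g j))"
    have xn: "norm (?x j) powr Q = C powr Q * (norm (g j) powr P / ?S)" for j
    proof -
      have "norm (?x j) = C * (norm (g j) / b) powr (P - 1)"
        using assms(3) by (simp only: norm_mult norm_of_real complex_mod_cnj) (simp add: norm_sgn)
      then show ?thesis
        using assms(3) b0 PQ by (simp add: powr_mult powr_powr powr_divide bP)
    qed
    have "(\<Sum>j<N. norm (?x j) powr Q) \<le> C powr Q" for N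
    proof -
      have "(\<Sum>j<N. norm (g j) powr P) / ?S \<le> 1"
        using S sg by (simp add: sum_le_suminf)
      then have "C powr Q * ((\<Sum>j<N. norm (g j) powr P) / ?S) \<le> C powr Q * 1"
        by (intro mult_left_mono) auto
      then show ?thesis unfolding xn by (simp add: sum_distrib_left sum_divide_distrib)
    qed
    then have "?x \<in> lq_ball q C" using 3 by (simp add: lq_ball_def)
    moreover have "?x j * g j = of_real (C * b * (norm (g j) powr P / ?S))" for j
    proof -
      have "(norm (g j) / b) powr (P - 1) * norm (g j) = b * (norm (g j) / b) powr P"
        using b0 by (cases "g j = 0") (simp_all add: powr_diff)
      then have "C * (norm (g j) / b) powr (P - 1) * norm (g j) = C * b * (norm (g j) powr P / ?S)"
        using b0 powr_divide[of "norm (g j)" b P] by (simp only: bP mult.assoc)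
      moreover have "?x j * g j = of_real (C * (norm (g j) / b) powr (P - 1) * norm (g j))"
        by (simp add: mult.assoc cnj_sgn_mult)
      ultimately show ?thesis by simp
    qed
    ultimately have "Re (\<Sum>j. complex_of_real (C * b * (norm (g j) powr P / ?S))) \<le> B"
      using B[of ?x] by simp
    also have "(\<Sum>j. complex_of_real (C * b * (norm (g j) powr P / ?S))) = of_real (\<Sum>j. C * b * (norm (g j) powr P / ?S))"
      by (intro suminf_of_real[symmetric] summable_mult summable_divide sg)
    also have "(\<Sum>j. C * b * (norm (g j) powr P / ?S)) = C * b"
      using S by (simp add: suminf_mult summable_divide sg suminf_divide)
    finally show ?thesis using b by simp
  qed
qed

section \<open>Moment problems on a compact convex set\<close>

text \<open>The hypothesis \<open>dual\<close> compares \<open>w\<close> with the support function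
  of the image of \<open>K\<close>. Quantifying over all upper bounds \<open>B\<close> expresses
  this without forming a supremum.\<close>

lemma moment_problem_compact_convex:
  fixes K :: "(nat \<Rightarrow> complex) set" and u :: "'i \<Rightarrow> nat \<Rightarrow> complex" and w :: "'i \<Rightarrow> complex"
  assumes "finite I" "compact K" "K \<noteq> {}"
    and conv: "\<And>x y t. x \<in> K \<Longrightarrow> y \<in> K \<Longrightarrow> 0 \<le> t \<Longrightarrow> t \<le> 1 \<Longrightarrow>
      (\<lambda>j. (1 - of_real t) * x j + of_real t * y j) \<in> K"
    and bound: "\<And>x j. x \<in> K \<Longrightarrow> norm (x j) \<le> C"
    and u: "\<And>i. i \<in> I \<Longrightarrow> summable (\<lambda>j. norm (u i j))"
    and dual: "\<And>\<alpha> B. (\<And>x. x \<in> K \<Longrightarrow> Re (\<Sum>j. x j * (\<Sum>i\<in>I. \<alpha> i * u i j)) \<le> B) \<Longrightarrow>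
      norm (\<Sum>i\<in>I. \<alpha> i * w i) \<le> B"
  shows "\<exists>x\<in>K. \<forall>i\<in>I. (\<Sum>j. x j * u i j) = w i"
proof -
  define T where "T x i = (\<Sum>j. x j * u i j)" for x i
  define \<phi> where "\<phi> x = (\<Sum>i\<in>I. (norm (w i - T x i))\<^sup>2)" for x
  have le: "norm (x j * u i j) \<le> C * norm (u i j)" if "x \<in> K" for x i j
    using bound[OF that] by (simp add: norm_mult mult_right_mono)
  have summ: "summable (\<lambda>j. x j * u i j)" if "x \<in> K" "i \<in> I" for x i
    by (rule summable_norm_cancel, rule summable_comparison_test'[of "\<lambda>j. C * norm (u i j)" 0])
      (use le[OF that(1)] u[OF that(2)] in \<open>auto intro!: summable_mult\<close>)
  \<comment> \<open>Partial sums depend on finitely many coordinates and converge uniformly on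
    \<open>K\<close>, with majorant \<open>C * norm (u i j)\<close>.\<close>
  have "continuous_on K (\<lambda>x. T x i)" if "i \<in> I" for i
  proof (rule uniform_limit_theorem)
    show "uniform_limit K (\<lambda>n x. \<Sum>j<n. x j * u i j) (\<lambda>x. T x i) sequentially"
      unfolding T_def by (rule Weierstrass_m_test[of K _ "\<lambda>j. C * norm (u i j)"])
        (use le u[OF that] in \<open>auto intro!: summable_mult\<close>)
    show "\<forall>\<^sub>F n in sequentially. continuous_on K (\<lambda>x. \<Sum>j<n. x j * u i j)"
      by (intro always_eventually allI continuous_intros)
        (auto intro: continuous_on_subset[OF continuous_on_product_coordinates])
  qed simp
  then have "continuous_on K \<phi>" unfolding \<phi>_def by (auto intro!: continuous_intros)
  then obtain x where x: "x \<in> K" and min: "\<And>y. y \<in> K \<Longrightarrow> \<phi> x \<le> \<phi> y"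
    using continuous_attains_inf[OF assms(2,3)] by blast
  \<comment> \<open>The conjugated residual of a best approximation separates \<open>w\<close> from the image of \<open>K\<close>.\<close>
  define \<alpha> where "\<alpha> i = cnj (w i - T x i)" for i
  have pairing: "(\<Sum>j. y j * (\<Sum>i\<in>I. \<alpha> i * u i j)) = (\<Sum>i\<in>I. \<alpha> i * T y i)" if "y \<in> K" for y
  proof -
    have "(\<Sum>j. y j * (\<Sum>i\<in>I. \<alpha> i * u i j)) = (\<Sum>j. \<Sum>i\<in>I. \<alpha> i * (y j * u i j))"
      by (simp add: sum_distrib_left algebra_simps)
    also have "\<dots> = (\<Sum>i\<in>I. \<Sum>j. \<alpha> i * (y j * u i j))"
      by (intro suminf_sum summable_mult summ that)
    also have "\<dots> = (\<Sum>i\<in>I. \<alpha> i * T y i)"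
      unfolding T_def by (intro sum.cong refl suminf_mult summ that)
    finally show ?thesis .
  qed
  \<comment> \<open>First-order optimality: moving from \<open>x\<close> towards \<open>y\<close> by
    \<open>t\<close> changes \<open>\<phi>\<close> by \<open>- 2 * t * S + t\<^sup>2 * D\<close>,
    which minimality makes nonnegative. Dividing by \<open>t\<close> and letting \<open>t\<close>
    tend to 0 from the right gives \<open>S \<le> 0\<close>.\<close>
  have var: "Re (\<Sum>i\<in>I. \<alpha> i * T y i) \<le> Re (\<Sum>i\<in>I. \<alpha> i * T x i)" if y: "y \<in> K" for y
  proof -
    define S where "S = Re (\<Sum>i\<in>I. \<alpha> i * (T y i - T x i))"
    define D where "D = (\<Sum>i\<in>I. (norm (T y i - T x i))\<^sup>2)"
    have "2 * S \<le> t * D" if t: "0 < t" "t \<le> 1" for t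
    proof -
      define z where "z = (\<lambda>j. (1 - of_real t) * x j + of_real t * y j)"
      have zK: "z \<in> K" unfolding z_def using conv[OF x y] t by simp
      have Tz: "T z i = T x i + of_real t * (T y i - T x i)" if "i \<in> I" for i
      proof -
        have "(\<lambda>j. (1 - of_real t) * (x j * u i j) + of_real t * (y j * u i j)) sums
            ((1 - of_real t) * T x i + of_real t * T y i)"
          unfolding T_def by (intro sums_add sums_mult summable_sums summ x y that)
        then have "T z i = (1 - of_real t) * T x i + of_real t * T y i"
          unfolding T_def[of z] unfolding z_def by (intro sums_unique[symmetric]) (simp add: algebra_simps)
        then show ?thesis by (simp add: algebra_simps)
      qed
      \<comment> \<open>Here \<open>a\<close> stands for the residual \<open>w i - T x i\<close>, so
        \<open>cnj a\<close> is \<open>\<alpha> i\<close>, and \<open>d\<close> for the direction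
        \<open>T y i - T x i\<close>.\<close>
      have expand: "(norm (a - of_real t * d))\<^sup>2 =
          (norm a)\<^sup>2 - 2 * t * Re (cnj a * d) + t\<^sup>2 * (norm d)\<^sup>2" for a d
        by (simp add: cmod_power2) (simp add: power2_eq_square algebra_simps)
      have "\<phi> z = (\<Sum>i\<in>I. (norm (w i - T x i))\<^sup>2 - 2 * t * Re (\<alpha> i * (T y i - T x i))
          + t\<^sup>2 * (norm (T y i - T x i))\<^sup>2)"
        unfolding \<phi>_def \<alpha>_def
        by (intro sum.cong refl) (simp add: Tz diff_diff_eq[symmetric] expand)
      also have "\<dots> = \<phi> x - 2 * t * S + t\<^sup>2 * D"
        unfolding \<phi>_def S_def D_def Re_sum by (simp only: sum.distrib sum_subtractf sum_distrib_left)
      finally have "t * (2 * S) \<le> t * (t * D)"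
        using min[OF zK] by (simp add: power2_eq_square algebra_simps)
      then show ?thesis using t by simp
    qed
    note small = this
    have "((\<lambda>t. t * D) \<longlongrightarrow> 0 * D) (at_right 0)" by (intro tendsto_intros)
    moreover have "eventually (\<lambda>t. 2 * S \<le> t * D) (at_right 0)"
      by (rule eventually_mono[OF eventually_at_right_real[of 0 1]]) (use small in auto)
    ultimately have "2 * S \<le> 0 * D"
      by (intro tendsto_lowerbound) auto
    then show ?thesis by (simp add: S_def algebra_simps sum_subtractf)
  qed
  \<comment> \<open>By \<open>var\<close> the pairing attains its maximum over \<open>K\<close> at
    \<open>x\<close>; this maximum serves as \<open>B\<close>.\<close>
  have "norm (\<Sum>i\<in>I. \<alpha> i * w i) \<le> Re (\<Sum>i\<in>I. \<alpha> i * T x i)"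
    by (rule dual) (use pairing var in metis)
  then have "Re (\<Sum>i\<in>I. \<alpha> i * w i) \<le> Re (\<Sum>i\<in>I. \<alpha> i * T x i)"
    using complex_Re_le_cmod order_trans by blast
  \<comment> \<open>Each \<open>\<alpha> i\<close> is the conjugate of the residual it multiplies,
    so the difference is the sum of squared residuals.\<close>
  moreover have "Re (\<Sum>i\<in>I. \<alpha> i * w i) - Re (\<Sum>i\<in>I. \<alpha> i * T x i) = \<phi> x"
    unfolding \<phi>_def \<alpha>_def
    by (simp add: sum_subtractf[symmetric] cmod_power2) (simp add: power2_eq_square algebra_simps)
  ultimately have "\<phi> x \<le> 0" by linarith
  moreover have "\<phi> x \<ge> 0" unfolding \<phi>_def by (simp add: sum_nonneg)
  ultimately have "\<phi> x = 0" by linarith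
  then have "\<forall>i\<in>I. (norm (w i - T x i))\<^sup>2 = 0"
    using assms(1) unfolding \<phi>_def by (subst (asm) sum_nonneg_eq_0_iff) auto
  then show ?thesis using x unfolding T_def by auto
qed

section \<open>Weights, Taylor coefficients and the weighted ball\<close>

lemma bs_weight_pos: "bs_weight \<gamma> j > 0"
  by (simp add: bs_weight_def)

lemma bs_weight_minus_mult: "bs_weight (- \<gamma>) j * bs_weight \<gamma> j = 1"
  by (simp add: bs_weight_def powr_add[symmetric])

text \<open>Geometric decay beats every power of \<open>j\<close>; the extra factor
  \<open>real j ^ 2\<close> that is still absorbed yields comparison with
  \<open>1 / real j ^ 2\<close>.\<close>

lemma summable_bs_weight_power:
  fixes z :: complex
  assumes "norm z < 1"
  shows "summable (\<lambda>j. norm (of_real (bs_weight \<beta> j) * z ^ j))"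
proof (cases "z = 0")
  case True
  then show ?thesis
    by (intro summable_finite[of "{0}"]) (auto simp: power_0_left)
next
  case False
  define r where "r = norm z"
  have r: "0 < r" "r < 1" using False assms by (auto simp: r_def)
  then have "((\<lambda>j::nat. real j powr \<beta> * r ^ j * real j ^ 2) \<longlongrightarrow> 0) at_top" by real_asymp
  then have "eventually (\<lambda>j::nat. real j powr \<beta> * r ^ j * real j ^ 2 < 1) at_top"
    by (rule order_tendstoD) simp
  then have "eventually (\<lambda>j. norm (norm (of_real (bs_weight \<beta> j) * z ^ j)) \<le> 1 / real j ^ 2) at_top"
    using eventually_gt_at_top[of 0]
  proof eventually_elim
    case (elim j)
    then show ?case
      by (simp add: norm_mult norm_power bs_weight_def r_def pos_le_divide_eq)
  qed
  then show ?thesis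
    by (rule summable_comparison_test_ev) (use inverse_power_summable[of 2, where 'a = real] in \<open>simp add: field_simps\<close>)
qed

lemma taylor_coeff_sums:
  assumes "f holomorphic_on ball 0 1" "z \<in> ball 0 1"
  shows "(\<lambda>j. taylor_coeff f j * z ^ j) sums f z"
  using holomorphic_power_series[OF assms] by (simp add: taylor_coeff_def fps_expansion_def)

text \<open>Uniqueness of power series at 0. Convergence at \<open>1 / 2\<close> supplies the
  positive radius that \<open>has_fps_expansion\<close> demands.\<close>

lemma taylor_coeff_of_sums:
  assumes "\<And>z. z \<in> ball 0 1 \<Longrightarrow> (\<lambda>j. c j * z ^ j) sums f z"
  shows "f holomorphic_on ball 0 1" "taylor_coeff f = c"
proof -
  show "f holomorphic_on ball 0 1"
    by (rule power_series_holomorphic[of 0 1 c]) (use assms in simp)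
  have "summable (\<lambda>j. c j * (1 / 2) ^ j)" using assms[of "1 / 2"] by (simp add: sums_iff)
  from conv_radius_geI[OF this] have "fps_conv_radius (Abs_fps c) \<ge> ereal (1 / 2)"
    by (simp add: fps_conv_radius_def)
  then have "0 < fps_conv_radius (Abs_fps c)"
    by (rule less_le_trans[rotated]) simp
  moreover have "eventually (\<lambda>z. eval_fps (Abs_fps c) z = f z) (nhds 0)"
  proof -
    have "eventually (\<lambda>z::complex. z \<in> ball 0 1) (nhds 0)"
      by (intro eventually_nhds_in_open) auto
    then show ?thesis
      by eventually_elim (use assms in \<open>simp add: eval_fps_def sums_iff\<close>)
  qed
  ultimately have "f has_fps_expansion Abs_fps c" by (simp add: has_fps_expansion_def)
  then show "taylor_coeff f = c"
    by (auto simp: taylor_coeff_def fps_expansion_eqI)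
qed

text \<open>Multiplying the coefficients by the positive weights turns the weighted norm into the
  plain \<open>l^q\<close> norm.\<close>

lemma bs_ball_iff_lq_ball:
  assumes "1 \<le> q" "C \<ge> 0"
  shows "f \<in> beurling_sobolev q \<gamma> \<and> bs_norm q \<gamma> f \<le> C \<longleftrightarrow>
    f holomorphic_on ball 0 1 \<and> (\<lambda>j. taylor_coeff f j * of_real (bs_weight \<gamma> j)) \<in> lq_ball q C"
  using bs_weight_pos[of \<gamma>]
  by (auto simp: lq_ball_iff[OF assms] lq_norm_def beurling_sobolev_def bs_norm_def norm_mult
      powr_mult less_imp_le)

section \<open>The interpolation criterion\<close>

theorem corollary6:
  fixes p q :: ennreal and \<beta> C :: real and n :: nat and lam w :: "nat \<Rightarrow> complex"
  assumes "1 \<le> q"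
    and "1 / p + 1 / q = 1"
    and "\<And>i. i \<in> {1..n} \<Longrightarrow> lam i \<in> ball 0 1"
    and "inj_on lam {1..n}"
    and "C > 0"
  shows "(\<exists>f \<in> beurling_sobolev q (- \<beta>). (\<forall>i\<in>{1..n}. f (lam i) = w i) \<and> bs_norm q (- \<beta>) f \<le> C)
    \<longleftrightarrow>
    (\<forall>\<alpha> :: nat \<Rightarrow> complex.
      norm (\<Sum>i=1..n. \<alpha> i * w i) \<le>
        C * (if p = \<infinity>
             then max (norm (\<Sum>i=1..n. \<alpha> i))
                      (SUP j\<in>{1..}. real j powr \<beta> * norm (\<Sum>i=1..n. \<alpha> i * lam i ^ j))
             else (norm (\<Sum>i=1..n. \<alpha> i) powr enn2real p +
                   (\<Sum>j. real (Suc j) powr (\<beta> * enn2real p) *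
                          norm (\<Sum>i=1..n. \<alpha> i * lam i ^ Suc j) powr enn2real p))
                  powr (1 / enn2real p)))"
    (is "?L \<longleftrightarrow> (\<forall>\<alpha>. norm (\<Sum>i=1..n. \<alpha> i * w i) \<le> C * ?R \<alpha>)")
proof -
  define u where "u i j = of_real (bs_weight \<beta> j) * lam i ^ j" for i j
  define g where "g \<alpha> j = (\<Sum>i=1..n. \<alpha> i * u i j)" for \<alpha> j
  have su: "summable (\<lambda>j. norm (u i j))" if "i \<in> {1..n}" for i
    unfolding u_def using assms(3)[OF that] by (intro summable_bs_weight_power) simp
  have sg: "summable (\<lambda>j. norm (g \<alpha> j))" for \<alpha>
  proof (rule summable_comparison_test')
    show "summable (\<lambda>j. \<Sum>i=1..n. norm (\<alpha> i) * norm (u i j))"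
      by (intro summable_sum summable_mult su)
    show "norm (norm (g \<alpha> j)) \<le> (\<Sum>i=1..n. norm (\<alpha> i) * norm (u i j))" for j
      unfolding g_def by (simp add: norm_mult[symmetric] norm_sum)
  qed
  have ng: "norm (g \<alpha> j) = bs_weight \<beta> j * norm (\<Sum>i=1..n. \<alpha> i * lam i ^ j)" for \<alpha> j
  proof -
    have "g \<alpha> j = of_real (bs_weight \<beta> j) * (\<Sum>i=1..n. \<alpha> i * lam i ^ j)"
      by (simp add: g_def u_def sum_distrib_left algebra_simps)
    then show ?thesis using bs_weight_pos[of \<beta> j] by (simp add: norm_mult)
  qed
  \<comment> \<open>Index 0 is split off because its weight is 1 and not
    \<open>0 powr \<beta>\<close>, which is 0; the remaining indices start at 1, hence the
    \<open>Suc j\<close> in the series.\<close>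
  have R: "?R \<alpha> = lq_norm p (g \<alpha>)" for \<alpha>
  proof (cases "p = \<infinity>")
    case True
    have bdd: "bdd_above ((\<lambda>j. norm (g \<alpha> j)) ` A)" for A
      using bdd_above_norm_of_summable[OF sg[of \<alpha>]] by (rule bdd_above_mono) auto
    have "UNIV = insert 0 {1::nat..}" by auto
    then have "(SUP j. norm (g \<alpha> j)) = (SUP j\<in>insert 0 {1..}. norm (g \<alpha> j))" by simp
    also have "\<dots> = sup (norm (g \<alpha> 0)) (SUP j\<in>{1..}. norm (g \<alpha> j))"
      by (rule cSUP_insert[OF _ bdd]) auto
    also have "(SUP j\<in>{1..}. norm (g \<alpha> j)) =
        (SUP j\<in>{1..}. real j powr \<beta> * norm (\<Sum>i=1..n. \<alpha> i * lam i ^ j))"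
      by (intro SUP_cong refl) (auto simp: ng bs_weight_def)
    finally show ?thesis using True by (simp add: lq_norm_def ng bs_weight_def sup_max)
  next
    case False
    have P: "enn2real p \<ge> 1"
      using assms(1,2) False by (cases rule: conjugate_exponent_cases) auto
    let ?f = "\<lambda>j. norm (g \<alpha> j) powr enn2real p"
    have "suminf ?f = ?f 0 + (\<Sum>j. ?f (Suc j))"
      using suminf_split_head[OF summable_norm_powr[OF sg P]] by simp
    then show ?thesis using False
      by (simp add: lq_norm_def ng bs_weight_def powr_mult powr_powr)
  qed
  \<comment> \<open>Interpolation becomes a moment problem: the weights in \<open>x\<close> and in
    \<open>u i\<close> cancel, so the pairing of the two is \<open>f (lam i)\<close>.\<close>
  have "?L \<longleftrightarrow> (\<exists>x\<in>lq_ball q C. \<forall>i\<in>{1..n}. (\<Sum>j. x j * u i j) = w i)"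
  proof
    assume ?L
    then obtain f where f: "f \<in> beurling_sobolev q (- \<beta>) \<and> bs_norm q (- \<beta>) f \<le> C"
      and fw: "\<And>i. i \<in> {1..n} \<Longrightarrow> f (lam i) = w i" by blast
    define x where "x j = taylor_coeff f j * of_real (bs_weight (- \<beta>) j)" for j
    have hol: "f holomorphic_on ball 0 1" and "x \<in> lq_ball q C"
      using f bs_ball_iff_lq_ball[OF assms(1)] assms(5) by (auto simp: x_def[abs_def])
    moreover have "(\<Sum>j. x j * u i j) = w i" if "i \<in> {1..n}" for i
    proof -
      have "x j * u i j = taylor_coeff f j * lam i ^ j" for j
      proof -
        have "x j * u i j = taylor_coeff f j * of_real (bs_weight (- \<beta>) j * bs_weight \<beta> j) * lam i ^ j"
          by (simp add: x_def u_def)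
        then show ?thesis by (simp add: bs_weight_minus_mult del: of_real_mult)
      qed
      then show ?thesis
        using taylor_coeff_sums[OF hol assms(3)[OF that]] fw[OF that] by (simp add: sums_iff)
    qed
    ultimately show "\<exists>x\<in>lq_ball q C. \<forall>i\<in>{1..n}. (\<Sum>j. x j * u i j) = w i" by blast
  next
    assume "\<exists>x\<in>lq_ball q C. \<forall>i\<in>{1..n}. (\<Sum>j. x j * u i j) = w i"
    then obtain x where x: "x \<in> lq_ball q C" and xw: "\<And>i. i \<in> {1..n} \<Longrightarrow> (\<Sum>j. x j * u i j) = w i"
      by blast
    \<comment> \<open>Multiplication by \<open>bs_weight \<beta>\<close> undoes the weight
      \<open>bs_weight (- \<beta>)\<close> carried by \<open>x\<close>.\<close>
    define c where "c j = x j * of_real (bs_weight \<beta> j)" for j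
    define f where "f z = (\<Sum>j. c j * z ^ j)" for z
    have "(\<lambda>j. c j * z ^ j) sums f z" if "z \<in> ball 0 1" for z
    proof -
      have "summable (\<lambda>j. norm (x j * (of_real (bs_weight \<beta> j) * z ^ j)))"
        using that x assms(1,5) by (intro summable_mult_lq_ball[of q C] summable_bs_weight_power) auto
      from summable_norm_cancel[OF this] show ?thesis
        unfolding f_def c_def by (intro summable_sums) (simp add: mult.assoc)
    qed
    note f = taylor_coeff_of_sums[OF this]
    have "(\<lambda>j. taylor_coeff f j * of_real (bs_weight (- \<beta>) j)) = x"
    proof
      fix j
      have "taylor_coeff f j * of_real (bs_weight (- \<beta>) j)
          = x j * of_real (bs_weight (- \<beta>) j * bs_weight \<beta> j)"
        using f(2) by (simp add: c_def)
      then show "taylor_coeff f j * of_real (bs_weight (- \<beta>) j) = x j"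
        by (simp add: bs_weight_minus_mult del: of_real_mult)
    qed
    then have "f \<in> beurling_sobolev q (- \<beta>) \<and> bs_norm q (- \<beta>) f \<le> C"
      using bs_ball_iff_lq_ball[OF assms(1)] assms(5) f(1) x by simp
    moreover have "f (lam i) = w i" if "i \<in> {1..n}" for i
      using xw[OF that] by (simp add: f_def c_def u_def mult.assoc)
    ultimately show ?L by blast
  qed
  also have "\<dots> \<longleftrightarrow> (\<forall>\<alpha>. norm (\<Sum>i=1..n. \<alpha> i * w i) \<le> C * lq_norm p (g \<alpha>))"
  proof
    assume "\<exists>x\<in>lq_ball q C. \<forall>i\<in>{1..n}. (\<Sum>j. x j * u i j) = w i"
    then obtain x where x: "x \<in> lq_ball q C" and xw: "\<And>i. i \<in> {1..n} \<Longrightarrow> (\<Sum>j. x j * u i j) = w i"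
      by blast
    show "\<forall>\<alpha>. norm (\<Sum>i=1..n. \<alpha> i * w i) \<le> C * lq_norm p (g \<alpha>)"
    proof
      fix \<alpha> :: "nat \<Rightarrow> complex"
      have s: "summable (\<lambda>j. x j * u i j)" if "i \<in> {1..n}" for i
        using summable_mult_lq_ball[OF assms(1) less_imp_le[OF assms(5)] x su[OF that]]
        by (rule summable_norm_cancel)
      have "(\<Sum>i=1..n. \<alpha> i * w i) = (\<Sum>i=1..n. \<Sum>j. \<alpha> i * (x j * u i j))"
        by (intro sum.cong refl) (simp add: suminf_mult s xw)
      also have "\<dots> = (\<Sum>j. \<Sum>i=1..n. \<alpha> i * (x j * u i j))"
        by (intro suminf_sum[symmetric] summable_mult s)
      also have "\<dots> = (\<Sum>j. x j * g \<alpha> j)"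
        by (simp add: g_def sum_distrib_left algebra_simps)
      finally show "norm (\<Sum>i=1..n. \<alpha> i * w i) \<le> C * lq_norm p (g \<alpha>)"
        using Hoelder_lq_ball[OF assms(1,2,5) x sg] by simp
    qed
  next
    assume H: "\<forall>\<alpha>. norm (\<Sum>i=1..n. \<alpha> i * w i) \<le> C * lq_norm p (g \<alpha>)"
    show "\<exists>x\<in>lq_ball q C. \<forall>i\<in>{1..n}. (\<Sum>j. x j * u i j) = w i"
    proof (rule moment_problem_compact_convex[where C = C])
      show "compact (lq_ball q C)" using lq_ball_compact assms by simp
      show "lq_ball q C \<noteq> {}" using zero_in_lq_ball[of C q] assms(5) by auto
      show "norm (x j) \<le> C" if "x \<in> lq_ball q C" for x j
        using norm_le_of_lq_ball that assms by simp
      \<comment> \<open>The converse of Hoelder gives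
        \<open>C * lq_norm p (g \<alpha>) \<le> B\<close>, and \<open>H\<close> bounds the left-hand
        side below by the combination of the \<open>w i\<close>.\<close>
      fix \<alpha> B
      assume "\<And>x. x \<in> lq_ball q C \<Longrightarrow> Re (\<Sum>j. x j * (\<Sum>i=1..n. \<alpha> i * u i j)) \<le> B"
      then have "C * lq_norm p (g \<alpha>) \<le> B"
        unfolding g_def[symmetric] by (intro lq_norm_le_of_lq_ball[OF assms(1,2,5) sg])
      then show "norm (\<Sum>i=1..n. \<alpha> i * w i) \<le> B" using H order_trans by blast
    qed (use su lq_ball_convex assms(1) in auto)
  qed
  finally show ?thesis unfolding R .
qed

end
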